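(* Let $G=P_t$ with $t\ge 2$, or $G=C_t$ with $t\geq 3$. Suppose that either $t$ is odd and $n\geq t$, or $t$ is even and either (1) $G=P_t$ and $n\geq \frac t2 + 2$, or (2) $G=C_t$ and $n\geq \frac t2$. Then \[ \gamma_P(G\times K_n)= \begin{cases} \left\lceil \frac t2 \right\rceil & \text{if } t\not\equiv 2 \pmod 4, \\ \frac t2 \text{ or } \frac t2 + 1 & \text{if } t\equiv 2 \pmod 4. \end{cases}\]
   Context: All graphs are finite, simple and undirected. $P_t$ is the path on $t$ vertices, $C_t$ the cycle on $t$ vertices, $K_n$ the complete graph on $n$ vertices. The tensor product $G\times H$ has vertex set $V(G)\times V(H)$, with $(g,h)$ adjacent to $(g',h')$ iff $g\sim g'$ in $G$ and $h\sim h'$ in $H$. Power domination: for $S\subseteq V(G)$ define $PD(S)$ by first setting $PD(S):=N[S]$ (the closed neighborhood of $S$), and then, while there is a vertex $v\in PD(S)$ with exactly one neighbor outside $PD(S)$, adding all neighbors of $v$ to $PD(S)$. $S$ is a power dominating set if at the end $PD(S)=V(G)$; $\gamma_P(G)$ is the minimum cardinality of a power dominating set. *)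

theory Defs
  imports Complex_Main "Graph_Theory.Kuratowski"
begin

text \<open>
  A finite simple undirected graph is a \<^typ>\<open>'a pair_pre_digraph\<close> satisfying the locale predicate
  \<^const>\<open>pair_graph\<close>: finite, irreflexive and symmetric, an undirected edge being represented by
  its two opposite arcs.
\<close>

definition path_graph :: "nat \<Rightarrow> nat pair_pre_digraph" where
  "path_graph t = \<lparr> pverts = {..<t},
     parcs = {(i, j). i < t \<and> j < t \<and> (j = Suc i \<or> i = Suc j)} \<rparr>"

text \<open>
  This is the cycle $C_t$ only for \<^term>\<open>t \<ge> 3\<close>: for \<^term>\<open>t = 2\<close> it degenerates to
  \<^term>\<open>path_graph 2\<close>, for \<^term>\<open>t = 1\<close> to a loop.
\<close>

definition cycle_graph :: "nat \<Rightarrow> nat pair_pre_digraph" where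
  "cycle_graph t = \<lparr> pverts = {..<t},
     parcs = {(i, j). i < t \<and> j < t \<and> (j = Suc i mod t \<or> i = Suc j mod t)} \<rparr>"

definition complete_graph :: "nat \<Rightarrow> nat pair_pre_digraph" where
  "complete_graph n = \<lparr> pverts = {..<n}, parcs = {(i, j). i < n \<and> j < n \<and> i \<noteq> j} \<rparr>"

definition tensor_product ::
    "'a pair_pre_digraph \<Rightarrow> 'b pair_pre_digraph \<Rightarrow> ('a \<times> 'b) pair_pre_digraph" where
  "tensor_product G H = \<lparr> pverts = pverts G \<times> pverts H,
     parcs = {((g, h), (g', h')). (g, g') \<in> parcs G \<and> (h, h') \<in> parcs H} \<rparr>"

lemma pair_graphI_sym:
  assumes "finite (pverts G)" "parcs G \<subseteq> pverts G \<times> pverts G" "sym (parcs G)" "irrefl (parcs G)"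
  shows "pair_graph G"
proof unfold_locales
  show "finite (parcs G)"
    using assms(1,2) by (meson finite_SigmaI finite_subset)
  show "symmetric (with_proj G)"
    using assms(3) by (simp add: symmetric_def)
next
  fix e assume "e \<in> parcs G"
  then show "fst e \<in> pverts G" "snd e \<in> pverts G" "fst e \<noteq> snd e"
    using assms(2,4) by (cases e; auto simp: irrefl_def)+
qed fact

lemma pair_graph_path_graph: "pair_graph (path_graph t)"
  by (rule pair_graphI_sym) (auto simp: path_graph_def sym_def irrefl_def)

lemma pair_graph_cycle_graph:
  assumes "t \<ge> 3"
  shows "pair_graph (cycle_graph t)"
proof -
  have "i \<noteq> Suc i mod t" if "i < t" for i
    using assms that by (cases "Suc i = t") auto
  then show ?thesis
    by (intro pair_graphI_sym) (auto simp: cycle_graph_def sym_def irrefl_def)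
qed

lemma complete_digraph_complete_graph: "complete_digraph n (with_proj (complete_graph n))"
  by (auto simp: complete_digraph_pair_def complete_graph_def)

lemma pair_graph_tensor_product:
  assumes "pair_graph G" "pair_graph H"
  shows "pair_graph (tensor_product G H)"
proof -
  interpret G: pair_graph G by fact
  interpret H: pair_graph H by fact
  show ?thesis
  proof (rule pair_graphI_sym)
    show "finite (pverts (tensor_product G H))"
      using G.pair_finite_verts H.pair_finite_verts by (simp add: tensor_product_def)
    show "parcs (tensor_product G H) \<subseteq> pverts (tensor_product G H) \<times> pverts (tensor_product G H)"
      by (auto simp: tensor_product_def dest: G.wellformed' H.wellformed')
    have "sym (parcs G)" "sym (parcs H)"
      using G.pair_sym_arcs H.pair_sym_arcs by (simp_all add: symmetric_def)
    then show "sym (parcs (tensor_product G H))"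
      by (auto simp: tensor_product_def sym_def)
    show "irrefl (parcs (tensor_product G H))"
      using G.pair_no_loops by (fastforce simp: tensor_product_def irrefl_def)
  qed
qed

definition nbhd :: "'a pair_pre_digraph \<Rightarrow> 'a \<Rightarrow> 'a set" where
  "nbhd G v = {w. (v, w) \<in> parcs G}"

definition closed_nbhd :: "'a pair_pre_digraph \<Rightarrow> 'a set \<Rightarrow> 'a set" where
  "closed_nbhd G S = S \<union> (\<Union>v\<in>S. nbhd G v)"

text \<open>
  The power domination process picks, while there is one, an arbitrary \<^term>\<open>v \<in> X\<close> with exactly
  one neighbour outside the current set \<^term>\<open>X\<close>. So \<open>pd_stage G S X\<close> says that
  \<^term>\<open>X\<close> occurs in some run started from \<^term>\<open>S\<close>, and \<open>pd_result G S X\<close> that some run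
  terminates with \<^term>\<open>X\<close>. By \<open>pd_result_unique\<close> and \<open>pd_result_exists\<close> below the result
  exists and does not depend on the choices made; it is the final value of $PD(S)$.
\<close>

inductive pd_stage :: "'a pair_pre_digraph \<Rightarrow> 'a set \<Rightarrow> 'a set \<Rightarrow> bool"
  for G :: "'a pair_pre_digraph" and S :: "'a set" where
  start: "pd_stage G S (closed_nbhd G S)"
| step: "\<lbrakk> pd_stage G S X; v \<in> X; card (nbhd G v - X) = 1 \<rbrakk> \<Longrightarrow> pd_stage G S (X \<union> nbhd G v)"

definition pd_result :: "'a pair_pre_digraph \<Rightarrow> 'a set \<Rightarrow> 'a set \<Rightarrow> bool" where
  "pd_result G S X \<longleftrightarrow> pd_stage G S X \<and> \<not> (\<exists>v\<in>X. card (nbhd G v - X) = 1)"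

definition power_dominating_set :: "'a pair_pre_digraph \<Rightarrow> 'a set \<Rightarrow> bool" where
  "power_dominating_set G S \<longleftrightarrow> S \<subseteq> pverts G \<and> pd_result G S (pverts G)"

definition power_domination_number :: "'a pair_pre_digraph \<Rightarrow> nat" where
  "power_domination_number G = Min (card ` {S. power_dominating_set G S})"

lemma pd_stage_subset_result:
  assumes "pd_stage G S Y" "pd_result G S X"
  shows "Y \<subseteq> X"
proof -
  have base: "closed_nbhd G S \<subseteq> X"
  proof -
    have "pd_stage G S X" using assms(2) by (simp add: pd_result_def)
    then show ?thesis by induction auto
  qed
  show ?thesis
    using assms(1)
  proof induction
    case start
    then show ?case by (fact base)
  next
    case (step Y v)
    then obtain w where w: "nbhd G v - Y = {w}"
      by (auto simp: card_1_singleton_iff)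
    have "card (nbhd G v - X) \<noteq> 1"
      using assms(2) step by (auto simp: pd_result_def)
    then have "nbhd G v - X \<noteq> {w}"
      by (metis is_singletonI is_singleton_altdef)
    moreover have "nbhd G v - X \<subseteq> {w}"
      using w step.IH by blast
    ultimately have "nbhd G v - X = {}"
      by (simp add: subset_singleton_iff)
    with step.IH show ?case by blast
  qed
qed

lemma pd_result_unique: "\<lbrakk> pd_result G S X; pd_result G S Y \<rbrakk> \<Longrightarrow> X = Y"
  by (meson pd_result_def pd_stage_subset_result subset_antisym)

lemma pd_stage_subset_verts:
  assumes "pair_graph G" "S \<subseteq> pverts G" "pd_stage G S X"
  shows "X \<subseteq> pverts G"
proof -
  interpret pair_graph G by fact
  have N: "nbhd G v \<subseteq> pverts G" for v
    by (auto simp: nbhd_def dest: arc_snd_in_verts)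
  show ?thesis
    using assms(3)
  proof induction
    case start
    then show ?case using assms(2) N by (auto simp: closed_nbhd_def)
  next
    case step
    then show ?case using N by blast
  qed
qed

lemma pd_result_exists:
  assumes "pair_graph G" "S \<subseteq> pverts G"
  shows "\<exists>X. pd_result G S X"
proof -
  interpret pair_graph G by fact
  have "{X. pd_stage G S X} \<subseteq> Pow (pverts G)"
    using pd_stage_subset_verts[OF assms] by blast
  then have "finite {X. pd_stage G S X}"
    using pair_finite_verts by (meson finite_Pow_iff finite_subset)
  moreover have "closed_nbhd G S \<in> {X. pd_stage G S X}"
    by (simp add: pd_stage.start)
  ultimately obtain X where X: "pd_stage G S X" and max: "\<And>Y. pd_stage G S Y \<Longrightarrow> X \<subseteq> Y \<Longrightarrow> X = Y"
    using finite_has_maximal2[of "{X. pd_stage G S X}" "closed_nbhd G S"] by auto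
  have "\<not> (\<exists>v\<in>X. card (nbhd G v - X) = 1)"
  proof
    assume "\<exists>v\<in>X. card (nbhd G v - X) = 1"
    then obtain v where v: "v \<in> X" "card (nbhd G v - X) = 1" by blast
    then have "X = X \<union> nbhd G v"
      using X max by (meson pd_stage.step sup_ge1)
    then have "nbhd G v - X = {}" by blast
    then show False using v(2) by (metis card.empty zero_neq_one)
  qed
  then show ?thesis using X by (auto simp: pd_result_def)
qed

lemma power_dominating_set_verts:
  assumes "pair_graph G"
  shows "power_dominating_set G (pverts G)"
proof -
  obtain X where X: "pd_result G (pverts G) X"
    using pd_result_exists[OF assms] by blast
  then have "X \<subseteq> pverts G"
    using pd_stage_subset_verts[OF assms] by (auto simp: pd_result_def)
  moreover have "pverts G \<subseteq> X"
    using pd_stage_subset_result[OF pd_stage.start X] by (auto simp: closed_nbhd_def)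
  ultimately show ?thesis
    using X by (simp add: power_dominating_set_def)
qed

end

theory Submission
  imports Defs
begin

text \<open>
  Upper bound: the two vertices \<open>(i, 0)\<close> and \<open>(i + 1, 0)\<close> dominate the fibres \<open>i\<close> and \<open>i + 1\<close>
  completely and the fibres \<open>i - 1\<close> and \<open>i + 2\<close> up to one vertex each, which is then forced. So two
  vertices take care of four consecutive fibres, and a single vertex \<open>(i, 0)\<close> suffices for one
  further fibre \<open>i + 1\<close> once the fibres \<open>i - 1\<close> and \<open>i\<close> are observed.

  Lower bound: as the degrees of \<open>G\<close> are at most 2, at least \<open>t - 2 |S|\<close> fibres have no element of
  \<open>S\<close> in a neighbouring fibre. If such a fibre contains at least 3 vertices outside \<open>S\<close>, none of
  these is ever observed, since each vertex of a neighbouring fibre is adjacent to all but at most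
  one of them. If \<open>2 |S| < t\<close>, the bounds on \<open>n\<close> provide such a fibre, except for \<open>t = 3\<close>, for
  \<open>C\<^sub>4\<close>, and for two vertices in antipodal fibres of \<open>C\<^sub>6 \<times> K\<^sub>3\<close>. There, explicit sets of
  vertices that can never be entered by the process are exhibited.
\<close>

section \<open>Bounding the power domination number, and closure properties of the final set\<close>

lemma power_domination_number_le:
  assumes "pair_graph G" "power_dominating_set G S"
  shows "power_domination_number G \<le> card S"
proof -
  interpret pair_graph G by fact
  have "finite {S. power_dominating_set G S}"
    by (rule finite_subset[of _ "Pow (pverts G)"])
      (auto simp: power_dominating_set_def pair_finite_verts)
  then show ?thesis
    unfolding power_domination_number_def using assms(2) by (intro Min_le) auto
qed

lemma power_domination_number_ge:
  assumes "pair_graph G" "\<And>S. power_dominating_set G S \<Longrightarrow> k \<le> card S"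
  shows "k \<le> power_domination_number G"
proof -
  interpret pair_graph G by fact
  have "finite {S. power_dominating_set G S}"
    by (rule finite_subset[of _ "Pow (pverts G)"])
      (auto simp: power_dominating_set_def pair_finite_verts)
  then show ?thesis
    unfolding power_domination_number_def
    using assms(2) power_dominating_set_verts[OF assms(1)] by (subst Min_ge_iff) auto
qed

lemma pd_result_closed_nbhd: "pd_result G S X \<Longrightarrow> closed_nbhd G S \<subseteq> X"
  by (rule pd_stage_subset_result[OF pd_stage.start])

lemma pd_result_subset: "pd_result G S X \<Longrightarrow> S \<subseteq> X"
  by (drule pd_result_closed_nbhd) (auto simp: closed_nbhd_def)

lemma pd_result_nbhd: "\<lbrakk> pd_result G S X; v \<in> S; w \<in> nbhd G v \<rbrakk> \<Longrightarrow> w \<in> X"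
  by (drule pd_result_closed_nbhd) (auto simp: closed_nbhd_def)

text \<open>If \<open>w\<close> were missing, it would be the only neighbour of \<open>v\<close>
  outside \<open>X\<close>, and the process could not have stopped at \<open>X\<close>.\<close>

lemma pd_result_force:
  assumes "pd_result G S X" "v \<in> X" "w \<in> nbhd G v" "nbhd G v - {w} \<subseteq> X"
  shows "w \<in> X"
proof (rule ccontr)
  assume "w \<notin> X"
  then have "nbhd G v - X = {w}" using assms(3,4) by auto
  then have "card (nbhd G v - X) = 1" by simp
  with assms(1,2) show False by (auto simp: pd_result_def)
qed

text \<open>A final set exists and lies inside \<open>pverts G\<close>, so it is enough that it
  contains every vertex. Upper bounds can thus use closure properties of \<open>X\<close> without
  scheduling the forcing steps.\<close>

lemma power_dominating_setI:
  assumes "pair_graph G" "S \<subseteq> pverts G" "\<And>X. pd_result G S X \<Longrightarrow> pverts G \<subseteq> X"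
  shows "power_dominating_set G S"
proof -
  obtain X where X: "pd_result G S X"
    using pd_result_exists[OF assms(1,2)] by blast
  moreover have "X \<subseteq> pverts G"
    using X pd_stage_subset_verts[OF assms(1,2)] by (auto simp: pd_result_def)
  ultimately show ?thesis
    using assms(2,3) by (metis power_dominating_set_def subset_antisym)
qed

text \<open>A set \<open>U\<close> with the last property is called a fort: the process cannot enter it from outside.\<close>

lemma not_power_dominating_if_fort:
  assumes "U \<noteq> {}" "U \<subseteq> pverts G" "U \<inter> closed_nbhd G S = {}"
    and fort: "\<And>v w. \<lbrakk> v \<notin> U; w \<in> U; w \<in> nbhd G v \<rbrakk> \<Longrightarrow> \<exists>w'\<in>U. w' \<noteq> w \<and> w' \<in> nbhd G v"
  shows "\<not> power_dominating_set G S"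
proof
  assume "power_dominating_set G S"
  then have "pd_stage G S (pverts G)"
    by (simp add: power_dominating_set_def pd_result_def)
  then have "U \<inter> pverts G = {}"
  proof induction
    case start
    then show ?case by (fact assms(3))
  next
    case (step X v)
    then obtain w0 where w0: "nbhd G v - X = {w0}"
      by (auto simp: card_1_singleton_iff)
    have "w \<notin> U" if "w \<in> nbhd G v" for w
    proof
      assume w: "w \<in> U"
      have "v \<notin> U" using step.IH step.hyps(2) by auto
      from fort[OF this w that] obtain w' where "w' \<in> U" "w' \<noteq> w" "w' \<in> nbhd G v" by auto
      moreover from this w have "w \<notin> X" "w' \<notin> X" using step.IH by auto
      ultimately have "w \<in> {w0}" "w' \<in> {w0}" using that unfolding w0[symmetric] by auto
      with \<open>w' \<noteq> w\<close> show False by auto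
    qed
    with step.IH show ?case by auto
  qed
  with assms(1,2) show False by blast
qed

section \<open>Neighbourhoods in paths, cycles and tensor products with a complete graph\<close>

lemma pverts_path_graph [simp]: "pverts (path_graph t) = {..<t}"
  by (simp add: path_graph_def)

lemma pverts_cycle_graph [simp]: "pverts (cycle_graph t) = {..<t}"
  by (simp add: cycle_graph_def)

lemma pverts_tensor_complete [simp]:
  "pverts (tensor_product G (complete_graph n)) = pverts G \<times> {..<n}"
  by (simp add: tensor_product_def complete_graph_def)

lemma nbhd_tensor_complete [simp]:
  "(j, b) \<in> nbhd (tensor_product G (complete_graph n)) (i, a) \<longleftrightarrow>
     j \<in> nbhd G i \<and> a < n \<and> b < n \<and> a \<noteq> b"
  by (simp add: nbhd_def tensor_product_def complete_graph_def)

lemma pair_graph_complete_graph: "pair_graph (complete_graph n)"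
  by (rule pair_graphI_sym) (auto simp: complete_graph_def sym_def irrefl_def)

lemmas pair_graph_tensor_complete =
  pair_graph_tensor_product[OF _ pair_graph_complete_graph]

lemma nbhd_sym:
  assumes "pair_graph G" "j \<in> nbhd G i"
  shows "i \<in> nbhd G j"
proof -
  interpret pair_graph G by fact
  show ?thesis using assms(2) arcs_symmetric by (simp add: nbhd_def)
qed

lemma nbhd_path_graph:
  "j \<in> nbhd (path_graph t) i \<longleftrightarrow> i < t \<and> j < t \<and> (j = Suc i \<or> i = Suc j)"
  by (simp add: nbhd_def path_graph_def)

lemma nbhd_cycle_graph:
  "j \<in> nbhd (cycle_graph t) i \<longleftrightarrow>
     i < t \<and> j < t \<and> (j = Suc i \<or> i = Suc j \<or> Suc i = t \<and> j = 0 \<or> Suc j = t \<and> i = 0)"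
  by (auto simp: nbhd_def cycle_graph_def mod_Suc)

lemma nbhd_path_graph_interior: "0 < i \<Longrightarrow> Suc i < t \<Longrightarrow> nbhd (path_graph t) i = {i - 1, Suc i}"
  by (auto simp: nbhd_path_graph)

lemma nbhd_cycle_graph_interior: "0 < i \<Longrightarrow> Suc i < t \<Longrightarrow> nbhd (cycle_graph t) i = {i - 1, Suc i}"
  by (auto simp: nbhd_cycle_graph)

lemma card_le_2I: "A \<subseteq> {x, y} \<Longrightarrow> card A \<le> 2"
  by (drule card_mono[rotated]) (auto simp: card_insert_if split: if_splits)

lemma card_nbhd_path_graph: "card (nbhd (path_graph t) i) \<le> 2"
  by (rule card_le_2I[of _ "Suc i" "i - 1"]) (auto simp: nbhd_path_graph)

lemma card_nbhd_cycle_graph: "card (nbhd (cycle_graph t) i) \<le> 2"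
  by (rule card_le_2I[of _ "if Suc i = t then 0 else Suc i" "if i = 0 then t - 1 else i - 1"])
    (auto simp: nbhd_cycle_graph)

section \<open>Upper bound for paths and cycles at once, through the neighbourhoods of interior
  vertices\<close>

context
  fixes G :: "nat pair_pre_digraph" and t n :: nat
  assumes G: "pair_graph G" and verts: "pverts G = {..<t}"
    and interior: "\<And>i. \<lbrakk> 0 < i; Suc i < t \<rbrakk> \<Longrightarrow> nbhd G i = {i - 1, Suc i}"
    and n: "2 \<le> n"
begin

lemma fibres_of_adjacent_pair:
  assumes "pd_result (tensor_product G (complete_graph n)) S X"
    and "(i, 0) \<in> S" "(j, 0) \<in> S" "j \<in> nbhd G i"
  shows "{i} \<times> {..<n} \<subseteq> X"
proof -
  have "i \<in> nbhd G j"
    by (rule nbhd_sym[OF G assms(4)])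
  then have "(i, a) \<in> X" if "a < n" "a \<noteq> 0" for a
    using that pd_result_nbhd[OF assms(1,3)] by auto
  moreover have "(i, 0) \<in> X"
    using assms(2) pd_result_subset[OF assms(1)] by auto
  ultimately show ?thesis by auto
qed

text \<open>Domination by \<open>(k, 0)\<close> leaves at most \<open>(l, 0)\<close> unobserved in
  fibre \<open>l\<close>. All other neighbours of \<open>(k, 1)\<close> are then observed, so this
  vertex forces it.\<close>

lemma fibre_forced:
  assumes R: "pd_result (tensor_product G (complete_graph n)) S X"
    and S: "(k, 0) \<in> S" and N: "nbhd G k = {l, r}"
    and X: "{k} \<times> {..<n} \<subseteq> X" "{r} \<times> {..<n} \<subseteq> X"
  shows "{l} \<times> {..<n} \<subseteq> X"
proof -
  have nz: "(l, a) \<in> X" if "a < n" "a \<noteq> 0" for a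
    using that pd_result_nbhd[OF R S] N by auto
  have "(l, 0) \<in> X"
  proof (rule pd_result_force[OF R])
    show "(k, 1) \<in> X" using X(1) n by auto
    show "(l, 0) \<in> nbhd (tensor_product G (complete_graph n)) (k, 1)" using N n by auto
    show "nbhd (tensor_product G (complete_graph n)) (k, 1) - {(l, 0)} \<subseteq> X"
    proof
      fix u assume u: "u \<in> nbhd (tensor_product G (complete_graph n)) (k, 1) - {(l, 0)}"
      obtain j b where "u = (j, b)" by (cases u)
      with u N X(2) nz show "u \<in> X" by (cases "j = r") auto
    qed
  qed
  with nz show ?thesis by auto
qed

lemma four_fibres:
  assumes R: "pd_result (tensor_product G (complete_graph n)) S X"
    and S: "(Suc i, 0) \<in> S" "(i + 2, 0) \<in> S" and t: "i + 3 < t" and j: "i \<le> j" "j \<le> i + 3"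
  shows "{j} \<times> {..<n} \<subseteq> X"
proof -
  \<comment> \<open>The outer neighbour is written first, in the place of \<open>l\<close> in
    \<open>fibre_forced\<close>.\<close>
  have N1: "nbhd G (Suc i) = {i, i + 2}" and N2: "nbhd G (i + 2) = {i + 3, Suc i}"
    using interior[of "Suc i"] interior[of "i + 2"] t by auto
  have 1: "{Suc i} \<times> {..<n} \<subseteq> X"
    by (rule fibres_of_adjacent_pair[OF R S]) (simp add: N1)
  have 2: "{i + 2} \<times> {..<n} \<subseteq> X"
    by (rule fibres_of_adjacent_pair[OF R S(2,1)]) (use N2 in blast)
  have 0: "{i} \<times> {..<n} \<subseteq> X"
    by (rule fibre_forced[OF R S(1) N1 1 2])
  have 3: "{i + 3} \<times> {..<n} \<subseteq> X"
    by (rule fibre_forced[OF R S(2) N2 2 1])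
  from j consider "j = i" | "j = Suc i" | "j = i + 2" | "j = i + 3" by linarith
  then show ?thesis using 0 1 2 3 by cases simp_all
qed

text \<open>The bound is t/2 rounded up, except for remainder 2 modulo 4: there the two fibres left
  over by the blocks of four still cost two vertices, which gives t/2 + 1.\<close>

lemma power_domination_number_upper:
  assumes t: "3 \<le> t"
  shows "power_domination_number (tensor_product G (complete_graph n))
           \<le> 2 * (t div 4) + (if t mod 4 = 0 then 0 else if t mod 4 = 1 then 1 else 2)"
proof -
  let ?H = "tensor_product G (complete_graph n)"
  define q where "q = t div 4"
  \<comment> \<open>For remainder 1 the vertex over \<open>t - 2\<close> forces the last fibre. For
    remainders 2 and 3 the vertices over \<open>t - 3\<close> and \<open>t - 2\<close> dominate
    these two fibres and then force fibre \<open>t - 1\<close>; for remainder 2, fibre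
    \<open>t - 3\<close> already belongs to the last block.\<close>
  define E where "E = (if t mod 4 = 0 then {} else if t mod 4 = 1 then {t - 2} else {t - 3, t - 2})"
  define I where "I = (\<lambda>m. 4 * m + 1) ` {..<q} \<union> (\<lambda>m. 4 * m + 2) ` {..<q} \<union> E"
  have tq: "t = 4 * q + t mod 4" by (simp add: q_def)
  have "card ((\<lambda>m. 4 * m + 1) ` {..<q} \<union> (\<lambda>m. 4 * m + 2) ` {..<q})
      \<le> card ((\<lambda>m. 4 * m + 1) ` {..<q}) + card ((\<lambda>m. 4 * m + 2) ` {..<q})"
    by (rule card_Un_le)
  also have "\<dots> \<le> q + q"
    using card_image_le[of "{..<q}"] by (intro add_mono) fastforce+
  finally have "card I \<le> q + q + card E"
    unfolding I_def by (meson add_le_mono1 card_Un_le order.trans)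
  also have "card E \<le> (if t mod 4 = 0 then 0 else if t mod 4 = 1 then 1 else 2)"
    by (auto simp: E_def card_insert_if)
  finally have cI: "card (I \<times> {0::nat})
      \<le> 2 * q + (if t mod 4 = 0 then 0 else if t mod 4 = 1 then 1 else 2)"
    by (simp add: card_cartesian_product)
  have "power_dominating_set ?H (I \<times> {0})"
  proof (rule power_dominating_setI)
    show "pair_graph ?H" by (rule pair_graph_tensor_complete[OF G])
    show "I \<times> {0} \<subseteq> pverts ?H"
      using n t tq by (auto simp: I_def E_def verts)
    fix X assume R: "pd_result ?H (I \<times> {0}) X"
    have low: "{j} \<times> {..<n} \<subseteq> X" if "j < 4 * q" for j
    proof (rule four_fibres[OF R, of "4 * (j div 4)"])
      have "j div 4 < q" using that by auto
      then show "(Suc (4 * (j div 4)), 0) \<in> I \<times> {0}" "(4 * (j div 4) + 2, 0) \<in> I \<times> {0}"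
        "4 * (j div 4) + 3 < t"
        using tq by (auto simp: I_def)
    qed presburger+
    have top: "nbhd G (t - 2) = {t - 1, t - 3}"
      using interior[of "t - 2"] t by (auto simp: numeral_eq_Suc Suc_diff_Suc)
    have high: "{j} \<times> {..<n} \<subseteq> X" if j: "4 * q \<le> j" "j < t" for j
    proof (cases "t mod 4 = 1")
      case True
      \<comment> \<open>As \<open>t = 4 * q + 1\<close>, the fibres \<open>t - 2\<close> and
        \<open>t - 3\<close> are the last two of the last block, where \<open>low\<close>
        applies.\<close>
      then have "j = t - 1" "t - 2 < 4 * q" "t - 3 < 4 * q" using tq j t by linarith+
      then show ?thesis
        using fibre_forced[OF R _ top low low] True by (auto simp: I_def E_def)
    next
      case False
      then have "t mod 4 \<in> {2, 3}" using tq j by auto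
      then have S: "(t - 3, 0) \<in> I \<times> {0}" "(t - 2, 0) \<in> I \<times> {0}"
        and "j = t - 3 \<or> j = t - 2 \<or> j = t - 1"
        using tq j by (auto simp: I_def E_def)
      moreover have N: "t - 3 \<in> nbhd G (t - 2)" by (simp add: top)
      then have "t - 2 \<in> nbhd G (t - 3)"
        by (rule nbhd_sym[OF G])
      then have 3: "{t - 3} \<times> {..<n} \<subseteq> X"
        by (rule fibres_of_adjacent_pair[OF R S])
      moreover have 2: "{t - 2} \<times> {..<n} \<subseteq> X"
        by (rule fibres_of_adjacent_pair[OF R S(2,1) N])
      moreover have "{t - 1} \<times> {..<n} \<subseteq> X"
        by (rule fibre_forced[OF R S(2) top 2 3])
      ultimately show ?thesis by blast
    qed
    show "pverts ?H \<subseteq> X"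
    proof
      fix v assume "v \<in> pverts ?H"
      then obtain j a where "v = (j, a)" "j < t" "a < n" by (auto simp: verts)
      then show "v \<in> X" using low[of j] high[of j] by (cases "j < 4 * q") auto
    qed
  qed
  then have "power_domination_number ?H \<le> card (I \<times> {0::nat})"
    by (rule power_domination_number_le[OF pair_graph_tensor_complete[OF G]])
  with cI show ?thesis by (simp add: q_def)
qed

end

text \<open>Here \<open>G\<close> has no interior vertex to force from, but the two chosen vertices
  already dominate both fibres.\<close>

lemma power_domination_number_P2_upper:
  assumes "2 \<le> n"
  shows "power_domination_number (tensor_product (path_graph 2) (complete_graph n)) \<le> 2"
proof -
  let ?H = "tensor_product (path_graph 2) (complete_graph n)"
  have G: "pair_graph ?H" by (intro pair_graph_tensor_complete pair_graph_path_graph)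
  have "power_dominating_set ?H {(0, 0), (1, 0)}"
  proof (rule power_dominating_setI[OF G])
    fix X assume R: "pd_result ?H {(0, 0), (1, 0)} X"
    have "{0} \<times> {..<n} \<subseteq> X"
      by (rule fibres_of_adjacent_pair[OF pair_graph_path_graph pverts_path_graph
            nbhd_path_graph_interior assms R, of 0 1]) (auto simp: nbhd_path_graph)
    moreover have "{1} \<times> {..<n} \<subseteq> X"
      by (rule fibres_of_adjacent_pair[OF pair_graph_path_graph pverts_path_graph
            nbhd_path_graph_interior assms R, of 1 0]) (auto simp: nbhd_path_graph)
    ultimately show "pverts ?H \<subseteq> X" by (auto simp: less_2_cases_iff)
  qed (use assms in auto)
  from power_domination_number_le[OF G this] show ?thesis by simp
qed

section \<open>Lower bound by counting the fibres not reached from \<open>S\<close>\<close>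

lemma not_power_dominating_if_sparse_fibre:
  assumes G: "pair_graph G" and i: "i \<in> pverts G"
    and away: "\<And>k a. (k, a) \<in> S \<Longrightarrow> i \<notin> nbhd G k"
    and few: "finite S" "card {a. (i, a) \<in> S} + 3 \<le> n"
  shows "\<not> power_dominating_set (tensor_product G (complete_graph n)) S"
proof (rule not_power_dominating_if_fort)
  let ?A = "{a. (i, a) \<in> S}" and ?H = "tensor_product G (complete_graph n)"
  let ?U = "{i} \<times> ({..<n} - ?A)"
  have fin: "finite ?A"
    by (rule finite_subset[of _ "snd ` S"]) (use few(1) in force)+
  \<comment> \<open>At least three vertices of the fibre lie outside \<open>S\<close>, so one of
    them avoids both the second coordinate \<open>a\<close> of \<open>w\<close> and the second
    coordinate \<open>b\<close> of \<open>v\<close>.\<close>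
  have fresh: "\<exists>c<n. c \<notin> ?A \<and> c \<noteq> a \<and> c \<noteq> b" for a b
  proof -
    have "card (?A \<union> {a, b}) \<le> card ?A + card {a, b}" by (rule card_Un_le)
    also have "\<dots> < card {..<n}" using few(2) by (simp add: card_insert_if)
    finally have "\<not> {..<n} \<subseteq> ?A \<union> {a, b}"
      using fin by (meson card_mono finite.emptyI finite.insertI finite_UnI leD)
    then show ?thesis by blast
  qed
  from fresh show "?U \<noteq> {}" by auto
  show "?U \<subseteq> pverts ?H" using i by auto
  show "?U \<inter> closed_nbhd ?H S = {}"
    using away by (auto simp: closed_nbhd_def)
  fix v w assume v: "v \<notin> ?U" and w: "w \<in> ?U" "w \<in> nbhd ?H v"
  obtain k b where "v = (k, b)" by (cases v)
  moreover obtain a where "w = (i, a)" using w(1) by auto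
  moreover obtain c where "c < n" "c \<notin> ?A" "c \<noteq> a" "c \<noteq> b" using fresh by blast
  ultimately show "\<exists>w'\<in>?U. w' \<noteq> w \<and> w' \<in> nbhd ?H v"
    using w by (intro bexI[of _ "(i, c)"]) auto
qed

text \<open>Every vertex outside the counted set is a neighbour of the first coordinate of some
  element of \<open>S\<close>, and each element accounts for at most two such vertices.\<close>

lemma card_verts_away_ge:
  assumes G: "pair_graph G" and deg: "\<And>i. card (nbhd G i) \<le> 2" and S: "finite S"
  shows "card (pverts G) \<le> card {i \<in> pverts G. \<forall>(k, a)\<in>S. i \<notin> nbhd G k} + 2 * card S"
proof -
  interpret pair_graph G by fact
  let ?Z = "{i \<in> pverts G. \<forall>(k, a)\<in>S. i \<notin> nbhd G k}"
  let ?N = "\<Union>v\<in>S. nbhd G (fst v)"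
  have "nbhd G i \<subseteq> pverts G" for i by (auto simp: nbhd_def dest: arc_snd_in_verts)
  then have "finite (nbhd G i)" for i
    using pair_finite_verts finite_subset by blast
  then have "card (pverts G) \<le> card (?Z \<union> ?N)"
    using pair_finite_verts S by (intro card_mono) fastforce+
  also have "\<dots> \<le> card ?Z + card ?N" by (rule card_Un_le)
  also have "card ?N \<le> (\<Sum>v\<in>S. card (nbhd G (fst v)))" by (rule card_UN_le[OF S])
  also have "\<dots> \<le> (\<Sum>v\<in>S. 2)" by (intro sum_mono deg)
  finally show ?thesis by simp
qed

lemma card_fibre_le: "finite S \<Longrightarrow> card {a. (i, a) \<in> S} \<le> card S"
  by (rule card_inj_on_le[of "Pair i"]) (auto intro: inj_onI)

lemma card_two_fibres_le:
  assumes "finite S" "i \<noteq> j"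
  shows "card {a. (i, a) \<in> S} + card {a. (j, a) \<in> S} \<le> card S"
proof -
  have "card {a. (i, a) \<in> S} + card {a. (j, a) \<in> S}
      = card (Pair i ` {a. (i, a) \<in> S}) + card (Pair j ` {a. (j, a) \<in> S})"
    by (simp add: card_image inj_on_def)
  also have "\<dots> = card (Pair i ` {a. (i, a) \<in> S} \<union> Pair j ` {a. (j, a) \<in> S})"
  proof (rule card_Un_disjoint[symmetric])
    show "finite (Pair i ` {a. (i, a) \<in> S})" "finite (Pair j ` {a. (j, a) \<in> S})"
      using assms(1) by (auto intro: finite_subset)
  qed (use assms in auto)
  also have "\<dots> \<le> card S" using assms by (intro card_mono) auto
  finally show ?thesis .
qed

text \<open>Counting yields a fibre not reached from \<open>S\<close>. At most \<open>card S\<close>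
  of its vertices are in \<open>S\<close>, so at least three are left.\<close>

lemma not_power_dominating_if_small:
  assumes G: "pair_graph G" "pverts G = {..<t}" and deg: "\<And>i. card (nbhd G i) \<le> 2"
    and S: "finite S" "2 * card S < t" "card S + 3 \<le> n"
  shows "\<not> power_dominating_set (tensor_product G (complete_graph n)) S"
proof -
  have "{i \<in> pverts G. \<forall>(k, a)\<in>S. i \<notin> nbhd G k} \<noteq> {}"
    using card_verts_away_ge[OF G(1) deg S(1)] S(2) G(2) by (auto simp del: Collect_empty_eq)
  then obtain i where "i \<in> pverts G" "\<And>k a. (k, a) \<in> S \<Longrightarrow> i \<notin> nbhd G k"
    by blast
  then show ?thesis
    using card_fibre_le[OF S(1), of i] S by (intro not_power_dominating_if_sparse_fibre G) auto
qed

section \<open>The exceptional cases with at most one chosen vertex: \<open>t = 3\<close> and the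
  4-cycle\<close>

lemma closed_nbhd_mono: "S \<subseteq> T \<Longrightarrow> closed_nbhd G S \<subseteq> closed_nbhd G T"
  by (auto simp: closed_nbhd_def)

lemma card_le_1_subset_singleton:
  assumes "finite S" "card S \<le> 1" "S \<subseteq> V" "V \<noteq> {}"
  shows "\<exists>v\<in>V. S \<subseteq> {v}"
  using assms by (cases "S = {}") (auto simp: le_Suc_eq card_1_singleton_iff)

lemma not_power_dominating_P3:
  assumes n: "3 \<le> n" and S: "S \<subseteq> {(j, a)}" "j < 3" "a < n"
  shows "\<not> power_dominating_set (tensor_product (path_graph 3) (complete_graph n)) S"
proof (cases "j = 1")
  case True
  show ?thesis
  \<comment> \<open>Both ends of the path have the centre as only neighbour, so these two vertices
    are twins. Sharing the second coordinate \<open>a\<close>, they are not adjacent to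
    \<open>(j, a)\<close>.\<close>
  proof (rule not_power_dominating_if_fort[of "{(0, a), (2, a)}"])
    show "{(0, a), (2, a)} \<inter> closed_nbhd (tensor_product (path_graph 3) (complete_graph n)) S = {}"
      using S True by (auto simp: closed_nbhd_def)
  qed (use S in \<open>auto simp: nbhd_path_graph\<close>)
next
  case False
  \<comment> \<open>The opposite end \<open>2 - j\<close> is not adjacent to \<open>j\<close>, and
    its fibre is disjoint from \<open>S\<close>.\<close>
  have "{b. (2 - j, b) \<in> S} = {}" using S False by auto
  then show ?thesis
    using n S False finite_subset[OF S(1)]
    by (intro not_power_dominating_if_sparse_fibre[of _ "2 - j"] pair_graph_path_graph)
      (auto simp: nbhd_path_graph simp del: Collect_empty_eq)
qed

lemma not_power_dominating_C3:
  assumes n: "3 \<le> n" and S: "S \<subseteq> {(j, a)}" "j < 3" "a < n"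
  shows "\<not> power_dominating_set (tensor_product (cycle_graph 3) (complete_graph n)) S"
proof -
  let ?H = "tensor_product (cycle_graph 3) (complete_graph n)"
  \<comment> \<open>The triangle is complete, so the vertices not dominated by \<open>(j, a)\<close>
    are those agreeing with it in exactly one coordinate.\<close>
  let ?U = "{(k, y). k < 3 \<and> y < n \<and> (k = j) \<noteq> (y = a)}"
  have N: "l \<in> nbhd (cycle_graph 3) k \<longleftrightarrow> k < 3 \<and> l < 3 \<and> k \<noteq> l" for k l
    by (auto simp: nbhd_cycle_graph)
  have third: "\<exists>z<m. z \<noteq> x \<and> z \<noteq> y" if "3 \<le> m" for m x y :: nat
  proof -
    have "card {x, y} < card {..<m}" using that by (simp add: card_insert_if)
    then have "\<not> {..<m} \<subseteq> {x, y}" by (meson card_mono finite.emptyI finite.insertI leD)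
    then show ?thesis by blast
  qed
  show ?thesis
  proof (rule not_power_dominating_if_fort)
    obtain k :: nat where "k < 3" "k \<noteq> j" using third[of 3 j j] by auto
    then show "?U \<noteq> {}" using S by blast
    show "?U \<subseteq> pverts ?H" by auto
    show "?U \<inter> closed_nbhd ?H S = {}"
      using S(1) by (auto simp: closed_nbhd_def N)
    fix v w assume v: "v \<notin> ?U" and w: "w \<in> ?U" "w \<in> nbhd ?H v"
    obtain k x l y where [simp]: "v = (k, x)" "w = (l, y)" by (cases v; cases w)
    have vw: "k \<noteq> j" "x \<noteq> a" "k < 3" "x < n" "k \<noteq> l" "x \<noteq> y" using v w by (auto simp: N)
    show "\<exists>w'\<in>?U. w' \<noteq> w \<and> w' \<in> nbhd ?H v"
    \<comment> \<open>The fort neighbours of \<open>v\<close> are the \<open>(j, c)\<close> with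
      \<open>c\<close> different from \<open>a\<close> and \<open>x\<close>, and one
      \<open>(m, a)\<close> with \<open>m\<close> different from \<open>j\<close> and
      \<open>k\<close>. The witness is taken from the kind to which \<open>w\<close> does not
      belong.\<close>
    proof (cases "l = j")
      case True
      obtain m where "m < 3" "m \<noteq> j" "m \<noteq> k" using third[of 3 j k] by auto
      then show ?thesis using vw S True by (intro bexI[of _ "(m, a)"]) (auto simp: N)
    next
      case False
      obtain c where "c < n" "c \<noteq> a" "c \<noteq> x" using third[OF n, of a x] by auto
      then show ?thesis using vw S False by (intro bexI[of _ "(j, c)"]) (auto simp: N)
    qed
  qed
qed

lemma less_numeral_cases:
  "(i::nat) < 3 \<longleftrightarrow> i = 0 \<or> i = 1 \<or> i = 2"
  "(i::nat) < 4 \<longleftrightarrow> i = 0 \<or> i = 1 \<or> i = 2 \<or> i = 3"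
  "(i::nat) < 6 \<longleftrightarrow> i = 0 \<or> i = 1 \<or> i = 2 \<or> i = 3 \<or> i = 4 \<or> i = 5"
  by auto

text \<open>The 4-cycle is complete bipartite, so the vertices with second coordinate
  \<open>a\<close> over the two neighbours of \<open>j\<close> are twins, and neither is adjacent to
  \<open>(j, a)\<close>.\<close>

lemma not_power_dominating_C4:
  assumes S: "S \<subseteq> {(j, a)}" "j < 4" "a < n"
  shows "\<not> power_dominating_set (tensor_product (cycle_graph 4) (complete_graph n)) S"
proof -
  let ?H = "tensor_product (cycle_graph 4) (complete_graph n)"
  let ?U = "nbhd (cycle_graph 4) j \<times> {a}"
  have N: "l \<in> nbhd (cycle_graph 4) k \<longleftrightarrow> k < 4 \<and> l < 4 \<and> (even k \<noteq> even l)" for k l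
    by (auto simp: nbhd_cycle_graph less_numeral_cases)
  have other: "\<exists>m<4. m \<noteq> l \<and> even m = even l" if "l < 4" for l :: nat
    using that by (intro exI[of _ "if l < 2 then l + 2 else l - 2"]) auto
  show ?thesis
  proof (rule not_power_dominating_if_fort)
    have "(if even j then 1 else 0) \<in> nbhd (cycle_graph 4) j" using S by (simp add: N)
    then show "?U \<noteq> {}" by blast
    show "?U \<subseteq> pverts ?H" using S by (auto simp: N)
    show "?U \<inter> closed_nbhd ?H S = {}"
      using S(1) by (auto simp: closed_nbhd_def N)
    fix v w assume v: "v \<notin> ?U" and w: "w \<in> ?U" "w \<in> nbhd ?H v"
    obtain k x l where [simp]: "v = (k, x)" "w = (l, a)" using w(1) by (cases v) auto
    obtain m where "m < 4" "m \<noteq> l" "even m = even l" using other[of l] w by (auto simp: N)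
    then show "\<exists>w'\<in>?U. w' \<noteq> w \<and> w' \<in> nbhd ?H v"
      using w by (intro bexI[of _ "(m, a)"]) (auto simp: N)
  qed
qed

section \<open>Two vertices in antipodal fibres over the hexagon, with \<open>n = 3\<close>\<close>

lemma nbhd_C6:
  "nbhd (cycle_graph 6) 0 = {1, 5}" "nbhd (cycle_graph 6) 1 = {0, 2}"
  "nbhd (cycle_graph 6) 2 = {1, 3}" "nbhd (cycle_graph 6) 3 = {2, 4}"
  "nbhd (cycle_graph 6) 4 = {3, 5}" "nbhd (cycle_graph 6) 5 = {0, 4}"
  by (auto simp: nbhd_cycle_graph)

text \<open>Vertices at distance two share a neighbour, so their closed neighbourhoods cover at most
  five of the six vertices.\<close>

lemma antipodal_C6:
  assumes "i < 6" "j < 6" "i \<noteq> j" "j \<notin> nbhd (cycle_graph 6) i"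
    and "{0, 1, 2, 3, 4, 5} \<subseteq> {i, j} \<union> nbhd (cycle_graph 6) i \<union> nbhd (cycle_graph 6) j"
  shows "j = i + 3 \<or> i = j + 3"
  using assms unfolding less_numeral_cases
  by (elim disjE; hypsubst; simp only: nbhd_C6; simp)

text \<open>The hexagon splits into two paths on three vertices, centred at \<open>i\<close> and
  \<open>j\<close>, with two edges joining their ends.\<close>

lemma nbhd_antipodal_C6:
  assumes "i < 6" "j < 6" "j = i + 3 \<or> i = j + 3"
  shows "i \<noteq> j" "j \<notin> nbhd (cycle_graph 6) i" "nbhd (cycle_graph 6) i \<inter> nbhd (cycle_graph 6) j = {}"
    and "{i, j} \<union> nbhd (cycle_graph 6) i \<union> nbhd (cycle_graph 6) j = {0, 1, 2, 3, 4, 5}"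
    and "card (nbhd (cycle_graph 6) i) = 2"
    and "\<forall>k\<in>nbhd (cycle_graph 6) i. \<exists>l\<in>nbhd (cycle_graph 6) j. nbhd (cycle_graph 6) k = {i, l}"
proof -
  have "i = 0 \<and> j = 3 \<or> i = 1 \<and> j = 4 \<or> i = 2 \<and> j = 5 \<or>
    i = 3 \<and> j = 0 \<or> i = 4 \<and> j = 1 \<or> i = 5 \<and> j = 2"
    using assms by presburger
  then show "i \<noteq> j" "j \<notin> nbhd (cycle_graph 6) i" "nbhd (cycle_graph 6) i \<inter> nbhd (cycle_graph 6) j = {}"
    "{i, j} \<union> nbhd (cycle_graph 6) i \<union> nbhd (cycle_graph 6) j = {0, 1, 2, 3, 4, 5}"
    "card (nbhd (cycle_graph 6) i) = 2"
    "\<forall>k\<in>nbhd (cycle_graph 6) i. \<exists>l\<in>nbhd (cycle_graph 6) j. nbhd (cycle_graph 6) k = {i, l}"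
    by (elim disjE conjE; hypsubst; simp only: nbhd_C6; auto simp: nbhd_C6 nbhd_C6[unfolded One_nat_def])+
qed

text \<open>The fort has two halves, exchanged by swapping \<open>(i, a)\<close> with
  \<open>(j, b)\<close>. By this symmetry, \<open>step\<close> only treats outside vertices over
  \<open>i\<close> and its neighbours.\<close>

lemma not_power_dominating_C6_K3:
  assumes S: "S \<subseteq> {(i, a), (j, b)}" "a < 3" "b < 3"
    and ij: "i < 6" "j < 6" "j = i + 3 \<or> i = j + 3"
  shows "\<not> power_dominating_set (tensor_product (cycle_graph 6) (complete_graph 3)) S"
proof -
  let ?N = "nbhd (cycle_graph 6)"
  let ?H = "tensor_product (cycle_graph 6) (complete_graph 3)"
  txt \<open>For \<open>a \<noteq> b\<close> the fort is what remains unobserved at the end of the process; for \<open>a = b\<close> no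
    forcing step is possible, and it is the set of all vertices that are not dominated.\<close>
  define V where "V i a b = {i} \<times> {y. y < 3 \<and> y \<noteq> a \<and> (a = b \<or> y = b)} \<union> ?N i \<times> {a}"
    for i a b :: nat
  have V: "(k, y) \<in> V i a b \<longleftrightarrow> k = i \<and> y < 3 \<and> y \<noteq> a \<and> (a = b \<or> y = b) \<or> k \<in> ?N i \<and> y = a"
    for k y i a b
    by (auto simp: V_def)
  have less6: "k < 6" "l < 6" if "l \<in> ?N k" for k l
    using that by (simp_all add: nbhd_cycle_graph)
  have sym: "k \<in> ?N l" if "l \<in> ?N k" for k l
    using that pair_graph_cycle_graph[of 6] nbhd_sym by simp
  have irrefl: "k \<notin> ?N k" for k
    by (auto simp: nbhd_cycle_graph)
  have step: "\<exists>w'\<in>V i a b \<union> V j b a. w' \<noteq> (l, y) \<and> w' \<in> nbhd ?H (k, x)"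
    if ij: "i < 6" "j < 6" "j = i + 3 \<or> i = j + 3" and ab: "a < 3" "b < 3"
      and v: "(k, x) \<notin> V i a b" and w: "(l, y) \<in> V i a b \<union> V j b a"
      and lk: "l \<in> ?N k" "x < 3" "y < 3" "x \<noteq> y" and k: "k = i \<or> k \<in> ?N i"
    for i j a b k x l y
  proof (cases "k = i")
    case True
    note F = nbhd_antipodal_C6[OF ij]
    \<comment> \<open>Over the neighbours of \<open>i\<close>, the fort has exactly the vertices
      with second coordinate \<open>a\<close>; the witness lies over the other neighbour.\<close>
    have y: "y = a"
      using w lk(1) F(2,3) irrefl[of i] unfolding True by (auto simp: V)
    obtain p q where "?N i = {p, q}" "p \<noteq> q"
      using F(5) by (auto simp: card_2_iff)
    then obtain m where "m \<in> ?N i" "m \<noteq> l" by (cases "p = l") auto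
    then show ?thesis
      using lk ab y unfolding True by (intro bexI[of _ "(m, a)"]) (auto simp: V)
  next
    case False
    note F = nbhd_antipodal_C6[OF ij]
    from False k have k: "k \<in> ?N i" by simp
    then have xa: "x \<noteq> a" using v by (auto simp: V)
    \<comment> \<open>The neighbours of \<open>(k, x)\<close> lie over \<open>i\<close> and over one
      neighbour \<open>m\<close> of \<open>j\<close>; a fort vertex over one of these is paired with
      a fort vertex over the other.\<close>
    obtain m where m: "m \<in> ?N j" "?N k = {i, m}" using F(6) k by auto
    have mi: "m \<noteq> i" using m(1) F(2) sym by auto
    have mN: "m \<notin> ?N i" using m(1) F(3) by auto
    have "m \<noteq> j" using m(1) irrefl by auto
    consider "l = i" | "l = m" using lk(1) m(2) by auto
    then show ?thesis
    proof cases
      case 1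
      have "i \<notin> ?N j" using F(2) sym by auto
      then have "x \<noteq> b" using w lk xa F(1) irrefl[of i] unfolding 1 by (auto simp: V)
      then show ?thesis
        using lk ab m mi unfolding 1 by (intro bexI[of _ "(m, b)"]) (auto simp: V)
    next
      case 2
      have y: "y = b" using w mi mN \<open>m \<noteq> j\<close> unfolding 2 by (auto simp: V)
      \<comment> \<open>If \<open>a\<close> and \<open>b\<close> differ, \<open>c\<close> must be
        \<open>b\<close>; if they agree, it is the third element besides \<open>x\<close> and
        \<open>a\<close>.\<close>
      obtain c :: nat where "c < 3" "c \<noteq> x" "c \<noteq> a" "a = b \<or> c = b"
      proof (cases "a = b")
        case True
        have "\<exists>c<3. c \<noteq> x \<and> c \<noteq> a" by (simp add: less_numeral_cases) presburger
        with True that show ?thesis by auto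
      next
        case False
        with that[of b] ab lk(4) y show ?thesis by auto
      qed
      then show ?thesis
        using lk m mi unfolding 2 by (intro bexI[of _ "(i, c)"]) (auto simp: V)
    qed
  qed
  note F = nbhd_antipodal_C6[OF ij]
  have ji: "i = j + 3 \<or> j = i + 3" using ij(3) by auto
  have "j \<notin> ?N j" "i \<notin> ?N i" "i \<notin> ?N j" using irrefl F(2) sym by auto
  show ?thesis
  proof (rule not_power_dominating_if_fort)
    show "V i a b \<union> V j b a \<subseteq> pverts ?H" using S ij less6 by (auto simp: V_def)
    have "?N i \<noteq> {}" using F(5) by auto
    then show "V i a b \<union> V j b a \<noteq> {}" by (auto simp: V_def)
    have "V i a b \<inter> closed_nbhd ?H {(i, a), (j, b)} = {}"
      using F(1-3) irrefl[of i] \<open>i \<notin> ?N j\<close> by (auto simp: closed_nbhd_def V)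
    moreover have "V j b a \<inter> closed_nbhd ?H {(i, a), (j, b)} = {}"
      using F(1-3) irrefl[of j] \<open>i \<notin> ?N j\<close> by (auto simp: closed_nbhd_def V)
    ultimately show "(V i a b \<union> V j b a) \<inter> closed_nbhd ?H S = {}"
      using closed_nbhd_mono[OF S(1), of ?H] by auto
    fix v w assume vw: "v \<notin> V i a b \<union> V j b a" "w \<in> V i a b \<union> V j b a" "w \<in> nbhd ?H v"
    obtain k x l y where [simp]: "v = (k, x)" "w = (l, y)" by (cases v; cases w)
    have lk: "l \<in> ?N k" "x < 3" "y < 3" "x \<noteq> y" using vw(3) by auto
    then have "k \<in> {0, 1, 2, 3, 4, 5}" using less6 by (auto simp: less_numeral_cases)
    then consider "k = i \<or> k \<in> ?N i" | "k = j \<or> k \<in> ?N j" unfolding F(4)[symmetric] by auto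
    then show "\<exists>w'\<in>V i a b \<union> V j b a. w' \<noteq> w \<and> w' \<in> nbhd ?H v"
    proof cases
      case 1
      then show ?thesis using step[OF ij S(2,3) _ _ lk] vw(1,2) by simp
    next
      case 2
      then show ?thesis
        using step[OF ij(2,1) ji S(3,2) _ _ lk] vw(1,2) by (simp add: Un_commute)
    qed
  qed
qed

section \<open>Even cycles, and the lower bound in all cases\<close>

lemma not_power_dominating_even_cycle:
  assumes t: "even t" "4 \<le> t" "t \<le> 2 * n"
    and S: "S \<subseteq> {..<t} \<times> {..<n}" "2 * card S < t"
  shows "\<not> power_dominating_set (tensor_product (cycle_graph t) (complete_graph n)) S"
proof
  assume pds: "power_dominating_set (tensor_product (cycle_graph t) (complete_graph n)) S"
  let ?N = "nbhd (cycle_graph t)" and ?f = "\<lambda>i. card {a. (i, a) \<in> S}"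
  have fin: "finite S" using S(1) by (rule finite_subset) simp
  have G: "pair_graph (cycle_graph t)" using t by (intro pair_graph_cycle_graph) simp
  define Z where "Z = {i \<in> pverts (cycle_graph t). \<forall>(k, a)\<in>S. i \<notin> ?N k}"
  have "t \<le> card Z + 2 * card S"
    using card_verts_away_ge[OF G card_nbhd_cycle_graph fin] by (simp add: Z_def)
  \<comment> \<open>Parity improves the strict inequality by one, which gives two unreached fibres
    instead of one.\<close>
  moreover have "2 * card S + 2 \<le> t" using S(2) t(1) by presburger
  ultimately have "2 \<le> card Z" by simp
  then obtain i j where Zij: "i \<in> Z" "j \<in> Z" "i \<noteq> j"
    by (meson card_2_iff' obtain_subset_with_card_n subsetD)
  have full: "n \<le> ?f k + 2" if "k \<in> Z" for k
    using pds that not_power_dominating_if_sparse_fibre[OF G, of k S n] fin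
    by (force simp: Z_def)
  have "?f i + ?f j \<le> card S" by (rule card_two_fibres_le[OF fin Zij(3)])
  with full[OF Zij(1)] full[OF Zij(2)] have "2 * n \<le> card S + 4" by simp
  \<comment> \<open>The chain 2n - 4 \<le> |S| \<le> t/2 - 1 \<le> n - 1 gives n \<le> 3, hence t
    \<le> 6.\<close>
  with S(2) t have "t = 4 \<or> t = 6 \<and> n = 3" by presburger
  then show False
  proof
    assume t4: "t = 4"
    then have "card S \<le> 1" using S(2) by simp
    moreover have "(0, 0) \<in> {..<t} \<times> {..<n}" using t by auto
    then have "{..<t} \<times> {..<n} \<noteq> {}" by blast
    ultimately obtain v where "v \<in> {..<t} \<times> {..<n}" "S \<subseteq> {v}"
      using card_le_1_subset_singleton[OF fin _ S(1)] by auto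
    then show False using not_power_dominating_C4 pds t4 by auto
  next
    assume t6: "t = 6 \<and> n = 3"
    have nonempty: "\<exists>a. (k, a) \<in> S" if "k \<in> Z" for k
      using full[OF that] t6 by (auto intro: ccontr)
    obtain a b where ab: "(i, a) \<in> S" "(j, b) \<in> S" using nonempty Zij by blast
    have "card S \<le> card {(i, a), (j, b)}" using S(2) t6 Zij(3) by simp
    then have Seq: "S = {(i, a), (j, b)}"
      using card_seteq[OF fin, of "{(i, a), (j, b)}"] ab by auto
    have lt: "i < 6" "j < 6" "a < 3" "b < 3" using ab S(1) t6 by auto
    have "j \<notin> ?N i" using Zij(2) ab by (auto simp: Z_def)
    \<comment> \<open>A vertex adjacent to neither \<open>i\<close> nor \<open>j\<close> belongs to
      \<open>Z\<close>, so its fibre meets \<open>S\<close>; hence it is \<open>i\<close> or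
      \<open>j\<close>.\<close>
    moreover have "{0, 1, 2, 3, 4, 5} \<subseteq> {i, j} \<union> ?N i \<union> ?N j"
    proof
      fix k :: nat assume "k \<in> {0, 1, 2, 3, 4, 5}"
      then have "k < 6" by auto
      then show "k \<in> {i, j} \<union> ?N i \<union> ?N j"
        using nonempty[of k] t6 by (auto simp: Z_def Seq)
    qed
    ultimately have "j = i + 3 \<or> i = j + 3"
      using lt Zij(3) t6 by (intro antipodal_C6) auto
    then show False
      using not_power_dominating_C6_K3[of S i a j b] lt Seq pds t6 by simp
  qed
qed

lemma power_domination_number_lower:
  assumes "(G = path_graph t \<and> t \<ge> 2 \<and> (odd t \<and> n \<ge> t \<or> even t \<and> 2 * n \<ge> t + 4)) \<or>
           (G = cycle_graph t \<and> t \<ge> 3 \<and> (odd t \<and> n \<ge> t \<or> even t \<and> 2 * n \<ge> t))"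
  shows "t \<le> 2 * power_domination_number (tensor_product G (complete_graph n))"
proof -
  let ?H = "tensor_product G (complete_graph n)"
  have G: "pair_graph G" "pverts G = {..<t}" and deg: "\<And>i. card (nbhd G i) \<le> 2"
    using assms pair_graph_path_graph pair_graph_cycle_graph
      card_nbhd_path_graph card_nbhd_cycle_graph by auto
  have "(t + 1) div 2 \<le> power_domination_number ?H"
  proof (rule power_domination_number_ge[OF pair_graph_tensor_complete[OF G(1)]], rule ccontr)
    fix S assume pds: "power_dominating_set ?H S" and "\<not> (t + 1) div 2 \<le> card S"
    then have small: "2 * card S < t" by linarith
    have S: "S \<subseteq> {..<t} \<times> {..<n}" using pds G(2) by (auto simp: power_dominating_set_def)
    then have fin: "finite S" by (rule finite_subset) simp
    have "n < card S + 3"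
      using not_power_dominating_if_small[OF G deg fin small, of n] pds by linarith
    \<comment> \<open>From t \<le> n \<le> |S| + 2 and 2|S| \<le> t - 1 it follows that t \<le>
      3.\<close>
    then have "t = 3 \<and> 3 \<le> n" if "odd t" "t \<le> n" "2 \<le> t"
      using small that by presburger
    \<comment> \<open>This excludes paths with \<open>t\<close> even.\<close>
    moreover have "\<not> t + 4 \<le> 2 * n"
      using small \<open>n < card S + 3\<close> by linarith
    moreover have "4 \<le> t" if "even t" "3 \<le> t"
      using that by presburger
    ultimately consider "t = 3" "3 \<le> n" "G = path_graph 3 \<or> G = cycle_graph 3"
      | "even t" "4 \<le> t" "t \<le> 2 * n" "G = cycle_graph t"
      using assms by fastforce
    then show False
    proof cases
      case 1
      then have "card S \<le> 1" "(0, 0) \<in> {..<t} \<times> {..<n}" using small by auto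
      then obtain v where "v \<in> {..<t} \<times> {..<n}" "S \<subseteq> {v}"
        using card_le_1_subset_singleton[OF fin _ S] by auto
      then show False
        using not_power_dominating_P3 not_power_dominating_C3 1 pds by auto
    next
      case 2
      then show False using not_power_dominating_even_cycle[OF 2(1-3) S small] pds by simp
    qed
  qed
  then show ?thesis by linarith
qed

theorem theorem3p6:
  fixes G :: "nat pair_pre_digraph" and t n :: nat
  assumes "(G = path_graph t \<and> t \<ge> 2 \<and>
             (odd t \<and> n \<ge> t \<or> even t \<and> real n \<ge> real t / 2 + 2)) \<or>
           (G = cycle_graph t \<and> t \<ge> 3 \<and>
             (odd t \<and> n \<ge> t \<or> even t \<and> real n \<ge> real t / 2))"
  shows "(t mod 4 \<noteq> 2 \<longrightarrow>
           int (power_domination_number (tensor_product G (complete_graph n))) = \<lceil>real t / 2\<rceil>) \<and>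
         (t mod 4 = 2 \<longrightarrow>
           real (power_domination_number (tensor_product G (complete_graph n))) = real t / 2 \<or>
           real (power_domination_number (tensor_product G (complete_graph n))) = real t / 2 + 1)"
proof -
  let ?p = "power_domination_number (tensor_product G (complete_graph n))"
  have "real n \<ge> real t / 2 + 2 \<longleftrightarrow> 2 * n \<ge> t + 4" "real n \<ge> real t / 2 \<longleftrightarrow> 2 * n \<ge> t"
    by linarith+
  with assms have *: "(G = path_graph t \<and> t \<ge> 2 \<and> (odd t \<and> n \<ge> t \<or> even t \<and> 2 * n \<ge> t + 4)) \<or>
           (G = cycle_graph t \<and> t \<ge> 3 \<and> (odd t \<and> n \<ge> t \<or> even t \<and> 2 * n \<ge> t))"
    by simp
  have lower: "t \<le> 2 * ?p" by (rule power_domination_number_lower[OF *])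
  from * have "2 \<le> t \<and> odd t \<and> t \<le> n \<or> even t \<and> t + 4 \<le> 2 * n \<or> even t \<and> 3 \<le> t \<and> t \<le> 2 * n"
    by linarith
  \<comment> \<open>In the last alternative \<open>t\<close> is even and at least 3, hence at least
    4.\<close>
  then have n: "2 \<le> n" by presburger
  have upper: "?p \<le> 2 * (t div 4) + (if t mod 4 = 0 then 0 else if t mod 4 = 1 then 1 else 2)"
  proof (cases "t = 2")
    case True
    then have "G = path_graph 2" using * by auto
    then show ?thesis using power_domination_number_P2_upper[OF n] True by simp
  next
    case False
    then have t: "3 \<le> t" using * by auto
    from * consider "G = path_graph t" | "G = cycle_graph t" by blast
    then show ?thesis
    proof cases
      case 1
      show ?thesis unfolding 1
        by (rule power_domination_number_upper[OF pair_graph_path_graph pverts_path_graph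
              nbhd_path_graph_interior n t])
    next
      case 2
      show ?thesis unfolding 2
        by (rule power_domination_number_upper[OF pair_graph_cycle_graph[OF t] pverts_cycle_graph
              nbhd_cycle_graph_interior n t])
    qed
  qed
  show ?thesis
  proof (intro conjI impI)
    assume "t mod 4 \<noteq> 2"
    \<comment> \<open>Outside remainder 2 the upper bound is t/2 rounded up and meets the lower
      bound.\<close>
    then have "t = 2 * ?p \<or> t + 1 = 2 * ?p" using lower upper by (auto split: if_splits) presburger+
    then show "int ?p = \<lceil>real t / 2\<rceil>"
      by (intro ceiling_unique[symmetric]) linarith+
  next
    assume "t mod 4 = 2"
    \<comment> \<open>The upper bound is now t/2 + 1, one more than the lower bound.\<close>
    then have "t = 2 * ?p \<or> t + 2 = 2 * ?p" using lower upper by (auto split: if_splits) presburger+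
    then show "real ?p = real t / 2 \<or> real ?p = real t / 2 + 1" by linarith
  qed
qed

end
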